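(* Let $n\ge 1$, let $S\subseteq V(G_n)$ be nonempty, let $r\ge 0$ be an integer, and let $X\subseteq V(G_n)$ be $S$-controlled with radius $r$, i.e. $X\subseteq N_S^{(\le r)}$. Then every vertex $\lambda\in V(G_n)$ admits an $S$-monotone inward geodesic to the controlled region $N_S^{(\le r)}$. If $d_S(\lambda)\ge r$, the length of such a geodesic is $d_S(\lambda)-r$.
   Context: Partition graph: for $n\ge 1$, the vertices of the simple graph $G_n$ are the partitions $\lambda=(\lambda_1\ge\dots\ge\lambda_k>0)$ of $n$. An elementary unit transfer on $\lambda=(\lambda_1,\dots,\lambda_k)$: choose distinct indices $i,j\in\{1,\dots,k\}$, replace $\lambda_i$ by $\lambda_i+1$ and $\lambda_j$ by $\lambda_j-1$, delete the latter if it becomes $0$, and reorder the parts into nonincreasing form; if the resulting partition $\mu$ satisfies $\mu\neq\lambda$, then $\mu$ is obtained from $\lambda$ by an elementary unit transfer. Two partitions $\lambda,\mu$ of $n$ are adjacent in $G_n$ if one of them is obtained from the other by a single elementary unit transfer. The graph $G_n$ is connected. For nonempty $S\subseteq V(G_n)$, $d_S(\lambda)=\min_{\sigma\in S}d_{G_n}(\lambda,\sigma)$, where $d_{G_n}$ is the graph distance, and $N_S^{(\le r)}=\{\mu\in V(G_n): d_S(\mu)\le r\}$. A path $(\lambda_0,\dots,\lambda_m)$ in $G_n$ (consecutive vertices adjacent; length $m\ge 0$, the one-vertex path having length $0$) is $S$-monotone inward if $d_S(\lambda_{i+1})=d_S(\lambda_i)-1$ for all $0\le i<m$. A geodesic from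 $\lambda$ to a nonempty set $Y\subseteq V(G_n)$ is a path from $\lambda$ to a vertex of $Y$ of minimum possible length, i.e. of length $d_Y(\lambda)$. *)

theory Defs
  imports "Graph_Theory.Graph_Theory"
begin

definition partition_of :: "nat \<Rightarrow> nat list \<Rightarrow> bool" where
  "partition_of n l \<longleftrightarrow> sorted_wrt (\<ge>) l \<and> (\<forall>x\<in>set l. 0 < x) \<and> sum_list l = n"

text \<open>
  Parts are indexed from 0. When all parts of \<^term>\<open>l\<close> are positive, the filter can
  only delete the decremented part.
\<close>
definition unit_transfer :: "nat list \<Rightarrow> nat \<Rightarrow> nat \<Rightarrow> nat list" where
  "unit_transfer l i j = rev (sort (filter (\<lambda>x. 0 < x) (l[i := l ! i + 1, j := l ! j - 1])))"

definition elementary_unit_transfer :: "nat list \<Rightarrow> nat list \<Rightarrow> bool" where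
  "elementary_unit_transfer l m \<longleftrightarrow>
     (\<exists>i<length l. \<exists>j<length l. i \<noteq> j \<and> m = unit_transfer l i j) \<and> m \<noteq> l"

text \<open>A simple graph is represented, as in \<^theory>\<open>Graph_Theory.Digraph\<close>, by a symmetric digraph.\<close>
definition partition_graph :: "nat \<Rightarrow> (nat list, nat list \<times> nat list) pre_digraph" where
  "partition_graph n = with_proj
     \<lparr> pverts = {l. partition_of n l},
       parcs = {(l, m). partition_of n l \<and> partition_of n m \<and>
                  (elementary_unit_transfer l m \<or> elementary_unit_transfer m l)} \<rparr>"

text \<open>
  The distances below are natural numbers, so they are meaningful only between vertices
  joined by a walk; \<open>partition_graph_connected\<close> below shows that this is always
  the case in the partition graph. The infimum of a nonempty set of natural numbers is its minimum.
\<close>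
definition graph_dist :: "('a, 'b) pre_digraph \<Rightarrow> 'a \<Rightarrow> 'a \<Rightarrow> nat" where
  "graph_dist G u v = (INF p \<in> {p. vwalk p G \<and> hd p = u \<and> last p = v}. vwalk_length p)"

definition set_dist :: "('a, 'b) pre_digraph \<Rightarrow> 'a set \<Rightarrow> 'a \<Rightarrow> nat" where
  "set_dist G S u = (INF s \<in> S. graph_dist G u s)"

definition set_nbhd :: "('a, 'b) pre_digraph \<Rightarrow> 'a set \<Rightarrow> nat \<Rightarrow> 'a set" where
  "set_nbhd G S r = {u \<in> verts G. set_dist G S u \<le> r}"

definition controlled :: "('a, 'b) pre_digraph \<Rightarrow> 'a set \<Rightarrow> nat \<Rightarrow> 'a set \<Rightarrow> bool" where
  "controlled G S r X \<longleftrightarrow> X \<subseteq> set_nbhd G S r"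

text \<open>
  Paths are given by their vertex lists; as \<^const>\<open>vwalk\<close>s they are nonempty and have adjacent
  consecutive vertices, with no distinctness requirement.
  The subtraction is taken in the integers to avoid truncation at 0.
\<close>
definition monotone_inward :: "('a, 'b) pre_digraph \<Rightarrow> 'a set \<Rightarrow> 'a list \<Rightarrow> bool" where
  "monotone_inward G S p \<longleftrightarrow> vwalk p G \<and>
     (\<forall>i<vwalk_length p. int (set_dist G S (p ! (i + 1))) = int (set_dist G S (p ! i)) - 1)"

definition geodesic_to :: "('a, 'b) pre_digraph \<Rightarrow> 'a \<Rightarrow> 'a set \<Rightarrow> 'a list \<Rightarrow> bool" where
  "geodesic_to G u Y p \<longleftrightarrow>
     vwalk p G \<and> hd p = u \<and> last p \<in> Y \<and> vwalk_length p = set_dist G Y u"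

lemma sum_list_filter_pos: "sum_list (filter (\<lambda>x. 0 < x) l) = sum_list (l :: nat list)"
  by (induction l) auto

lemma partition_of_unit_transfer:
  assumes "partition_of n l" "i < length l" "j < length l" "i \<noteq> j"
  shows "partition_of n (unit_transfer l i j)"
proof -
  let ?l = "l[i := l ! i + 1]"
  have pos: "0 < l ! j"
    using assms by (simp add: partition_of_def)
  have "l ! j \<le> sum_list ?l"
    using assms elem_le_sum_list[of j ?l] by simp
  moreover have "sum_list ?l = n + 1"
    using assms elem_le_sum_list[of i l] by (simp add: sum_list_update partition_of_def)
  ultimately have "sum_list (?l[j := l ! j - 1]) = n"
    using assms pos by (simp add: sum_list_update)
  moreover have "sum_list (sort xs) = sum_list xs" for xs :: "nat list"
    by (metis mset_sort sum_mset_sum_list)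
  ultimately have "sum_list (unit_transfer l i j) = n"
    by (simp add: unit_transfer_def sum_list_filter_pos)
  then show ?thesis
    by (auto simp: partition_of_def unit_transfer_def sorted_wrt_rev)
qed

lemma partition_graph_simps:
  "verts (partition_graph n) = {l. partition_of n l}"
  "arcs_ends (partition_graph n) = {(l, m). partition_of n l \<and> partition_of n m \<and>
     (elementary_unit_transfer l m \<or> elementary_unit_transfer m l)}"
  by (simp_all add: partition_graph_def)

lemma finite_partitions: "finite {l. partition_of n l}"
proof (rule finite_subset)
  have "length l \<le> sum_list l" if "\<forall>x\<in>set l. 0 < x" for l :: "nat list"
    using that by (induction l) auto
  then show "{l. partition_of n l} \<subseteq> {l. set l \<subseteq> {..n} \<and> length l \<le> n}"
    by (auto simp: partition_of_def member_le_sum_list)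
qed (simp add: finite_lists_length_le)

lemma partition_graph_graph: "graph (partition_graph n)"
proof -
  let ?A = "{(l, m). partition_of n l \<and> partition_of n m \<and>
                  (elementary_unit_transfer l m \<or> elementary_unit_transfer m l)}"
  let ?G = "\<lparr> pverts = {l. partition_of n l}, parcs = ?A \<rparr>"
  have fin: "finite ?A"
    by (rule finite_subset[OF _ finite_cartesian_product[OF finite_partitions[of n] finite_partitions[of n]]]) auto
  have "pair_graph ?G"
    by unfold_locales
      (auto simp: finite_partitions symmetric_def sym_def elementary_unit_transfer_def
        intro: fin[unfolded elementary_unit_transfer_def])
  then interpret pair_graph ?G .
  show ?thesis
    unfolding partition_graph_def by unfold_locales
qed

lemma partition_graph_reaches_single:
  assumes "n \<ge> 1" "partition_of n l"
  shows "l \<rightarrow>\<^sup>*\<^bsub>partition_graph n\<^esub> [n]"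
  using assms(2)
proof (induction "n - Max (set l)" arbitrary: l rule: less_induct)
  case less
  interpret graph "partition_graph n"
    by (rule partition_graph_graph)
  have ne: "l \<noteq> []"
    using less.prems assms(1) by (auto simp: partition_of_def)
  show ?case
  proof (cases "length l = 1")
    case True
    then have "l = [n]"
      using less.prems by (auto simp: partition_of_def length_Suc_conv)
    then show ?thesis
      using less.prems by (auto simp: partition_graph_simps)
  next
    case False
    obtain i where i: "i < length l" "l ! i = Max (set l)"
      using Max_in[of "set l"] ne by (auto simp: in_set_conv_nth)
    have "length l \<noteq> 0"
      using ne by simp
    then have "1 < length l"
      using False by linarith
    define j :: nat where "j = (if i = 0 then 1 else 0)"
    have j: "j < length l" "j \<noteq> i"
      using \<open>1 < length l\<close> by (auto simp: j_def)
    let ?m = "unit_transfer l i j"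
    have m: "partition_of n ?m"
      using partition_of_unit_transfer[OF less.prems i(1) j(1)] j(2) by simp
    have "?m ! k \<le> n" if "k < length ?m" for k
      using m elem_le_sum_list[OF that] by (simp add: partition_of_def)
    then have le: "x \<le> n" if "x \<in> set ?m" for x
      using that by (auto simp: in_set_conv_nth)
    have "l[i := l ! i + 1, j := l ! j - 1] ! i = l ! i + 1"
      using i j by simp
    then have "l ! i + 1 \<in> set (l[i := l ! i + 1, j := l ! j - 1])"
      using nth_mem[of i "l[i := l ! i + 1, j := l ! j - 1]"] i(1) by simp
    then have mem: "Max (set l) + 1 \<in> set ?m"
      using i by (simp add: unit_transfer_def)
    then have lt: "Max (set l) < Max (set ?m)"
      using Max_ge[OF finite_set mem] by linarith
    then have "elementary_unit_transfer l ?m"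
      using i j by (auto simp: elementary_unit_transfer_def)
    then have "(l, ?m) \<in> arcs_ends (partition_graph n)"
      using m less.prems by (simp add: partition_graph_simps)
    moreover have "n - Max (set ?m) < n - Max (set l)"
      using lt le[OF mem] by linarith
    then have "?m \<rightarrow>\<^sup>*\<^bsub>partition_graph n\<^esub> [n]"
      using less.hyps m by blast
    ultimately show ?thesis
      using adj_reachable_trans by blast
  qed
qed

lemma partition_graph_connected:
  assumes "n \<ge> 1"
  shows "strongly_connected (partition_graph n)"
proof -
  interpret graph "partition_graph n"
    by (rule partition_graph_graph)
  have "partition_of n [n]"
    using assms by (simp add: partition_of_def)
  moreover have "l \<rightarrow>\<^sup>*\<^bsub>partition_graph n\<^esub> m" if "partition_of n l" "partition_of n m" for l m
    by (rule reachable_trans[OF partition_graph_reaches_single[OF assms that(1)]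
          symmetric_reachable[OF sym_arcs partition_graph_reaches_single[OF assms that(2)]]])
  ultimately show ?thesis
    by (auto simp: strongly_connected_def partition_graph_simps)
qed

end

theory Submission
  imports Defs
begin

text \<open>
  The distance \<open>d\<close> to \<open>S\<close> can drop by at most one per step of a walk
  (\<open>set_dist_lipschitz\<close>), whereas a shortest walk from \<open>u\<close> to \<open>S\<close> brings it from \<open>d u\<close>
  down to 0 in \<open>d u\<close> steps. On such a walk it therefore drops by exactly one at every step
  (\<open>set_dist_along_geodesic\<close>). The initial segment of length \<open>d u - r\<close> (truncated
  subtraction) thus ends in the \<open>r\<close>-neighbourhood of \<open>S\<close> and is monotone inward. No walk
  from \<open>u\<close> enters that neighbourhood sooner, again because \<open>d\<close> drops by at most one per step; so the initial
  segment is a geodesic to the neighbourhood, and every such geodesic has length \<open>d u - r\<close>.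

  The argument works in any strongly connected digraph; the partition graph is one by
  \<open>partition_graph_connected\<close>.
\<close>

lemma set_dist_le_vwalk_length:
  assumes "vwalk p G" and "last p \<in> S"
  shows "set_dist G S (hd p) \<le> vwalk_length p"
proof -
  have "set_dist G S (hd p) \<le> graph_dist G (hd p) (last p)"
    unfolding set_dist_def using assms(2) by (intro cINF_lower) auto
  also have "\<dots> \<le> vwalk_length p"
    unfolding graph_dist_def using assms(1) by (intro cINF_lower) auto
  finally show ?thesis .
qed

context wf_digraph
begin

text \<open>Strong connectedness makes both infima in the definition of the distance range over
  nonempty sets, so that they are attained.\<close>

lemma ex_geodesic_to:
  assumes "strongly_connected G" and "S \<subseteq> verts G" and "S \<noteq> {}" and "u \<in> verts G"
  shows "\<exists>p. geodesic_to G u S p"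
proof -
  have "set_dist G S u \<in> graph_dist G u ` S"
    unfolding set_dist_def using assms(3) by (intro Inf_nat_def1) auto
  then obtain s where s: "s \<in> S" "set_dist G S u = graph_dist G u s"
    by auto
  have "u \<rightarrow>\<^sup>* s"
    using assms s(1) by (auto simp: strongly_connected_def)
  then have "{p. vwalk p G \<and> hd p = u \<and> last p = s} \<noteq> {}"
    by (auto simp: reachable_vwalk_conv)
  then have "graph_dist G u s \<in> vwalk_length ` {p. vwalk p G \<and> hd p = u \<and> last p = s}"
    unfolding graph_dist_def by (intro Inf_nat_def1) auto
  then show ?thesis
    using s by (auto simp: geodesic_to_def)
qed

text \<open>A walk followed by a shortest walk from its end to \<open>S\<close> is a walk to \<open>S\<close>.\<close>

lemma set_dist_lipschitz:
  assumes "strongly_connected G" and "S \<subseteq> verts G" and "S \<noteq> {}" and "vwalk p G"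
  shows "set_dist G S (hd p) \<le> vwalk_length p + set_dist G S (last p)"
proof -
  have "last p \<in> verts G"
    using assms(4) by (auto simp: vwalk_def)
  then obtain q where q: "geodesic_to G (last p) S q"
    using ex_geodesic_to assms by blast
  then have join: "joinable p q" "vwalk q G" "last q \<in> S"
    "vwalk_length q = set_dist G S (last p)"
    using assms(4) by (auto simp: geodesic_to_def joinable_def vwalk_def)
  have "vwalk (p \<oplus> q) G"
    using assms(4) join by (intro vwalk_joinI_vwalk)
  moreover have "hd (p \<oplus> q) = hd p" "last (p \<oplus> q) = last q"
    using join(1) by (simp_all add: vwalk_join_hd vwalk_join_last)
  moreover have "vwalk_length (p \<oplus> q) = vwalk_length p + vwalk_length q"
    using join(1) by (cases p; cases q) (auto simp: vwalk_join_def joinable_def)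
  ultimately show ?thesis
    using set_dist_le_vwalk_length[of "p \<oplus> q" G S] join(3,4) by simp
qed

text \<open>The segment before position \<open>i\<close> bounds the distance at \<open>i\<close> from below by
  the Lipschitz property; the segment after it, being a walk to \<open>S\<close>, bounds it from above.\<close>

lemma set_dist_along_geodesic:
  assumes "strongly_connected G" and "S \<subseteq> verts G" and "S \<noteq> {}"
    and "geodesic_to G u S p" and "i < length p"
  shows "set_dist G S (p ! i) + i = set_dist G S u"
proof -
  have p: "vwalk p G" "hd p = u" "last p \<in> S" "length p - 1 = set_dist G S u"
    using assms(4) by (auto simp: geodesic_to_def)
  have "vwalk (take (Suc i) p) G"
    using p(1) assms(5) vwalkI_append_l[of "take (Suc i) p" "drop (Suc i) p" G] by auto
  moreover have "hd (take (Suc i) p) = u" "vwalk_length (take (Suc i) p) = i"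
    using p(2) assms(5) by simp_all
  moreover have "last (take (Suc i) p) = p ! i"
    using assms(5) by (simp add: take_Suc_conv_app_nth)
  ultimately have "set_dist G S u \<le> i + set_dist G S (p ! i)"
    using set_dist_lipschitz[OF assms(1-3), of "take (Suc i) p"] by simp
  moreover have "vwalk (drop i p) G"
    using p(1) assms(5) vwalkI_append_r[of "drop i p" "take i p" G] by auto
  then have "set_dist G S (p ! i) \<le> length p - i - 1"
    using set_dist_le_vwalk_length[of "drop i p" G S] p(3) assms(5) by (simp add: hd_drop_conv_nth)
  ultimately show ?thesis
    using p(4) assms(5) by linarith
qed

lemma monotone_inward_prefix_of_geodesic:
  assumes "strongly_connected G" and "S \<subseteq> verts G" and "S \<noteq> {}"
    and "geodesic_to G u S p" and "k < length p"
  shows "monotone_inward G S (take (Suc k) p)"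
  unfolding monotone_inward_def
proof (intro conjI allI impI)
  show "vwalk (take (Suc k) p) G"
    using assms(4,5) vwalkI_append_l[of "take (Suc k) p" "drop (Suc k) p" G]
    by (auto simp: geodesic_to_def)
  fix i assume "i < vwalk_length (take (Suc k) p)"
  then have "i < k" "Suc i < length p"
    using assms(5) by auto
  then show "int (set_dist G S (take (Suc k) p ! (i + 1))) =
      int (set_dist G S (take (Suc k) p ! i)) - 1"
    using set_dist_along_geodesic[OF assms(1-4), of i]
      set_dist_along_geodesic[OF assms(1-4), of "Suc i"] by simp
qed

text \<open>The walk is the initial segment, of length \<open>set_dist G S u - r\<close>, of a shortest walk
  to \<open>S\<close>. If \<open>u\<close> already lies in the neighbourhood, the truncated subtraction makes it the
  one-vertex walk at \<open>u\<close>.\<close>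

lemma ex_monotone_inward_walk_to_set_nbhd:
  assumes "strongly_connected G" and "S \<subseteq> verts G" and "S \<noteq> {}" and "u \<in> verts G"
  shows "\<exists>q. monotone_inward G S q \<and> hd q = u \<and> last q \<in> set_nbhd G S r \<and>
    vwalk_length q = set_dist G S u - r"
proof -
  obtain p where p: "geodesic_to G u S p"
    using ex_geodesic_to[OF assms] by blast
  define k where "k = set_dist G S u - r"
  have walk: "p \<noteq> []" "set p \<subseteq> verts G" "hd p = u" "length p - 1 = set_dist G S u"
    using p by (auto simp: geodesic_to_def vwalk_def)
  then have k: "k < length p"
    by (cases p) (auto simp: k_def)
  have "p ! k \<in> verts G"
    using walk(2) nth_mem[OF k] by blast
  moreover have "set_dist G S (p ! k) \<le> r"
    using set_dist_along_geodesic[OF assms(1-3) p k] by (simp add: k_def)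
  ultimately have "last (take (Suc k) p) \<in> set_nbhd G S r"
    using k by (simp add: set_nbhd_def take_Suc_conv_app_nth)
  moreover have "vwalk_length (take (Suc k) p) = k" "hd (take (Suc k) p) = u"
    using k walk(3) by simp_all
  ultimately show ?thesis
    using monotone_inward_prefix_of_geodesic[OF assms(1-3) p k] unfolding k_def by blast
qed

lemma set_dist_set_nbhd:
  assumes "strongly_connected G" and "S \<subseteq> verts G" and "S \<noteq> {}" and "u \<in> verts G"
  shows "set_dist G (set_nbhd G S r) u = set_dist G S u - r"
proof (rule antisym)
  let ?N = "set_nbhd G S r"
  obtain q where q: "monotone_inward G S q" "hd q = u" "last q \<in> ?N"
    "vwalk_length q = set_dist G S u - r"
    using ex_monotone_inward_walk_to_set_nbhd[OF assms] by blast
  have "vwalk q G"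
    using q(1) by (simp add: monotone_inward_def)
  from set_dist_le_vwalk_length[OF this q(3)]
  show "set_dist G ?N u \<le> set_dist G S u - r"
    unfolding q(2,4) .
  have "last q \<in> ?N" "?N \<subseteq> verts G"
    using q(3) by (auto simp: set_nbhd_def)
  then obtain p where p: "geodesic_to G u ?N p"
    using ex_geodesic_to[of ?N u] assms(1,4) by blast
  then have "set_dist G S (last p) \<le> r" "vwalk p G" "hd p = u" "vwalk_length p = set_dist G ?N u"
    unfolding geodesic_to_def set_nbhd_def by blast+
  then show "set_dist G S u - r \<le> set_dist G ?N u"
    using set_dist_lipschitz[OF assms(1-3), of p] by simp
qed

lemma ex_monotone_inward_geodesic_to_set_nbhd:
  assumes "strongly_connected G" and "S \<subseteq> verts G" and "S \<noteq> {}" and "u \<in> verts G"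
  shows "\<exists>p. geodesic_to G u (set_nbhd G S r) p \<and> monotone_inward G S p"
  using ex_monotone_inward_walk_to_set_nbhd[OF assms, of r]
  unfolding geodesic_to_def set_dist_set_nbhd[OF assms]
  by (auto simp: monotone_inward_def)

end

theorem proposition5p10:
  fixes n r :: nat and S X :: "nat list set"
  assumes "n \<ge> 1"
    and "S \<subseteq> verts (partition_graph n)" and "S \<noteq> {}"
    and "controlled (partition_graph n) S r X"
  shows "\<forall>l \<in> verts (partition_graph n).
      (\<exists>p. geodesic_to (partition_graph n) l (set_nbhd (partition_graph n) S r) p \<and>
           monotone_inward (partition_graph n) S p) \<and>
      (set_dist (partition_graph n) S l \<ge> r \<longrightarrow>
        (\<forall>p. geodesic_to (partition_graph n) l (set_nbhd (partition_graph n) S r) p \<and>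
             monotone_inward (partition_graph n) S p \<longrightarrow>
             vwalk_length p = set_dist (partition_graph n) S l - r))"
proof (intro ballI conjI impI allI)
  interpret graph "partition_graph n"
    by (rule partition_graph_graph)
  note conn = partition_graph_connected[OF assms(1)]
  fix l assume l: "l \<in> verts (partition_graph n)"
  show "\<exists>p. geodesic_to (partition_graph n) l (set_nbhd (partition_graph n) S r) p \<and>
      monotone_inward (partition_graph n) S p"
    by (rule ex_monotone_inward_geodesic_to_set_nbhd[OF conn assms(2,3) l])
  fix p
  assume "geodesic_to (partition_graph n) l (set_nbhd (partition_graph n) S r) p \<and>
      monotone_inward (partition_graph n) S p"
  then show "vwalk_length p = set_dist (partition_graph n) S l - r"
    using set_dist_set_nbhd[OF conn assms(2,3) l] by (simp add: geodesic_to_def)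
qed

end
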